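(* There is no non-trivial m.d.s. which is $\mathcal{F}_{\mathrm{s}}$-independent of order $2$.
   Context: $\mathbb{Z}_+=\{0,1,2,\dots\}$. A m.d.s. $(X,\mathcal{B},\mu,T)$ consists of a Lebesgue space $(X,\mathcal{B},\mu)$ (i.e. $\mathcal{B}$ is the Borel $\sigma$-algebra of some Polish topology on $X$ and $\mu$ is a probability measure on $\mathcal{B}$) and a measurable map $T:X\to X$ with $\mu(T^{-1}B)=\mu(B)$ for all $B\in\mathcal{B}$ ($T$ need not be invertible). It is non-trivial if there is $B\in\mathcal{B}$ with $0<\mu(B)<1$. A set $F\subseteq\mathbb{Z}_+$ is an independence set for a tuple $(A_1,\dots,A_k)$ of sets in $\mathcal{B}$ if for every nonempty finite $J\subseteq F$ and every $s\in\{1,\dots,k\}^J$ one has $\mu(\bigcap_{j\in J}T^{-j}A_{s(j)})>0$. $\mathrm{Ind}(A_1,\dots,A_k)$ denotes the collection of all such independence sets. For an upward-hereditary collection $\mathcal{F}$ of subsets of $\mathbb{Z}_+$, the m.d.s. is $\mathcal{F}$-independent of order $k$ if $\mathrm{Ind}(A_1,\dots,A_k)\cap\mathcal{F}\neq\emptyset$ for all $A_1,\dots,A_k\in\mathcal{B}$ of positive measure. An infinite set $\{s_1<s_2<\cdots\}\subseteq\mathbb{Z}_+$ is syndetic if $\{s_{n+1}-s_n:n\in\mathbb{N}\}$ is bounded; $\mathcal{F}_{\mathrm{s}}$ is the family of syndetic sets. *)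

theory Defs
  imports "HOL-Probability.Probability"
begin

text \<open>The Polish topology is only required to exist; it is not part of the structure. The measure
  is not completed: the measurable sets are exactly the Borel sets of that topology.\<close>

definition lebesgue_space :: "'a measure \<Rightarrow> bool" where
  "lebesgue_space M \<longleftrightarrow> prob_space M \<and>
     (\<exists>X. completely_metrizable_space X \<and> separable_space X \<and>
          space M = topspace X \<and> sets M = sigma_sets (topspace X) {U. openin X U})"

definition mds :: "'a measure \<Rightarrow> ('a \<Rightarrow> 'a) \<Rightarrow> bool" where
  "mds M T \<longleftrightarrow> lebesgue_space M \<and> T \<in> measurable M M \<and>
     (\<forall>B\<in>sets M. measure M (T -` B \<inter> space M) = measure M B)"

definition nontrivial :: "'a measure \<Rightarrow> bool" where
  "nontrivial M \<longleftrightarrow> (\<exists>B\<in>sets M. 0 < measure M B \<and> measure M B < 1)"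

text \<open>A \<open>k\<close>-tuple of sets is a function on \<^typ>\<open>nat\<close> of which only the values on \<open>{1..k}\<close>
  matter.\<close>

definition independence_set ::
    "'a measure \<Rightarrow> ('a \<Rightarrow> 'a) \<Rightarrow> nat \<Rightarrow> (nat \<Rightarrow> 'a set) \<Rightarrow> nat set \<Rightarrow> bool" where
  "independence_set M T k A F \<longleftrightarrow>
     (\<forall>J s. J \<subseteq> F \<and> finite J \<and> J \<noteq> {} \<and> s \<in> J \<rightarrow> {1..k} \<longrightarrow>
        measure M (\<Inter>j\<in>J. (T ^^ j) -` A (s j) \<inter> space M) > 0)"

definition Ind ::
    "'a measure \<Rightarrow> ('a \<Rightarrow> 'a) \<Rightarrow> nat \<Rightarrow> (nat \<Rightarrow> 'a set) \<Rightarrow> nat set set" where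
  "Ind M T k A = {F. independence_set M T k A F}"

definition family_independent ::
    "nat set set \<Rightarrow> 'a measure \<Rightarrow> ('a \<Rightarrow> 'a) \<Rightarrow> nat \<Rightarrow> bool" where
  "family_independent \<F> M T k \<longleftrightarrow>
     (\<forall>A. (\<forall>i\<in>{1..k}. A i \<in> sets M \<and> measure M (A i) > 0) \<longrightarrow> Ind M T k A \<inter> \<F> \<noteq> {})"

definition syndetic :: "nat set \<Rightarrow> bool" where
  "syndetic S \<longleftrightarrow> infinite S \<and> bdd_above (range (\<lambda>n. enumerate S (Suc n) - enumerate S n))"

definition syndetic_family :: "nat set set" where
  "syndetic_family = {S. syndetic S}"

end

theory Submission
  imports Defs
begin

text \<open>
  The independence hypothesis fails already for a pair \<open>(A, A)\<close>, for a suitable set \<open>A\<close> of positive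
  measure. Such an \<open>A\<close> is built so that for every \<open>N\<close> there is a bound \<open>L\<close> with the property that
  almost every orbit, within \<open>L\<close> steps of any given time, begins an absence from \<open>A\<close> of \<open>N\<close>
  consecutive steps (\<open>exists_set_with_long_absences\<close>). A syndetic set with gaps at most \<open>N\<close> meets each
  such absence that begins after its first element, so almost no point is in \<open>A\<close> at all the times
  of a sufficiently long finite piece of it.

  To build \<open>A\<close>, choose for each \<open>N\<close> a marker set \<open>B\<^sub>N\<close> that almost every orbit visits within a
  bounded time, and let \<open>A\<close> omit \<open>B\<^sub>N\<close> together with its preimages under fewer than \<open>N\<close> steps. This
  leaves positive measure provided \<open>B\<^sub>N\<close> can be chosen with measure as small as desired.
  Small markers come from a skyscraper: if almost every orbit enters a set \<open>C\<close>, the points whose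
  first entrance time to \<open>C\<close> is divisible by \<open>n\<close> are visited within \<open>n\<close> steps. Since the levels of the
  skyscraper decrease in measure, these points have measure at most \<open>1/n\<close> plus that of \<open>C\<close>
  (\<open>skyscraper_marker\<close>).

  What remains is to find sets \<open>C\<close> of small positive measure that almost every orbit enters. Here
  independence of order 2 is used: two distinct times suffice to see that every set of positive measure
  is entered almost surely, and that every set of measure strictly between 0 and 1 yields one of positive
  measure at most half as large.
\<close>

section \<open>Measure-preserving maps and small marker sets\<close>

locale measure_preserving_map = prob_space +
  fixes T :: "'a \<Rightarrow> 'a"
  assumes T_measurable [measurable]: "T \<in> measurable M M"
    and T_preserves: "B \<in> sets M \<Longrightarrow> measure M (T -` B \<inter> space M) = measure M B"
begin

abbreviation pre :: "nat \<Rightarrow> 'a set \<Rightarrow> 'a set" where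
  "pre n B \<equiv> (T ^^ n) -` B \<inter> space M"

lemma funpow_measurable [measurable]: "T ^^ n \<in> measurable M M"
  by (induction n) auto

lemma funpow_in_space: "x \<in> space M \<Longrightarrow> (T ^^ n) x \<in> space M"
  using funpow_measurable measurable_space by metis

lemma pre_in_sets [measurable, simp]: "B \<in> sets M \<Longrightarrow> pre n B \<in> sets M"
  by (rule measurable_sets[OF funpow_measurable])

lemma pre_Suc: "pre (Suc n) B = T -` pre n B \<inter> space M"
  using measurable_space[OF T_measurable] by (auto simp: funpow_swap1)

lemma measure_pre: "B \<in> sets M \<Longrightarrow> measure M (pre n B) = measure M B"
proof (induction n)
  case 0
  then show ?case using sets.sets_into_space[of B M] by (simp add: Int_absorb2)
next
  case (Suc n)
  then show ?case using T_preserves[of "pre n B"] by (simp add: pre_Suc del: funpow.simps)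
qed

lemma AE_funpow:
  assumes "AE x in M. P x"
  shows "AE x in M. P ((T ^^ n) x)"
proof -
  obtain Z where Z: "{x \<in> space M. \<not> P x} \<subseteq> Z" "Z \<in> sets M" "emeasure M Z = 0"
    using assms by (auto elim!: AE_E)
  have "pre n Z \<in> null_sets M"
    using Z measure_pre[of Z n] by (auto simp: emeasure_eq_measure)
  moreover have "{x \<in> space M. \<not> P ((T ^^ n) x)} \<subseteq> pre n Z"
    using Z(1) funpow_in_space by auto
  ultimately show ?thesis by (rule AE_I')
qed

definition first_entrance :: "'a set \<Rightarrow> nat \<Rightarrow> 'a set" where
  "first_entrance C k = pre k C - (\<Union>i<k. pre i C)"

lemma first_entrance_in_sets [measurable, simp]:
  "C \<in> sets M \<Longrightarrow> first_entrance C k \<in> sets M"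
  unfolding first_entrance_def by auto

lemma disjoint_first_entrance: "disjoint_family (first_entrance C)"
proof -
  have "first_entrance C m \<inter> first_entrance C n = {}" if "m < n" for m n
    using that by (auto simp: first_entrance_def)
  then show ?thesis
    unfolding disjoint_family_on_def by (metis Int_commute linorder_neqE_nat)
qed

lemma funpow_first_entrance:
  assumes x: "x \<in> first_entrance C k" and "i \<le> k"
  shows "(T ^^ i) x \<in> first_entrance C (k - i)"
proof -
  have sp: "x \<in> space M" and hit: "(T ^^ k) x \<in> C" and first: "\<And>l. l < k \<Longrightarrow> (T ^^ l) x \<notin> C"
    using x by (auto simp: first_entrance_def)
  have "(T ^^ (k - i)) ((T ^^ i) x) \<in> C"
    using hit \<open>i \<le> k\<close> by (simp flip: funpow_add[unfolded comp_def, THEN fun_cong])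
  moreover have "(T ^^ l) ((T ^^ i) x) \<notin> C" if "l < k - i" for l
    using first[of "l + i"] that by (simp add: funpow_add)
  ultimately show ?thesis
    using sp by (auto simp: first_entrance_def funpow_in_space)
qed

text \<open>One step of the map takes level \<open>k + 1\<close> of the skyscraper over \<open>C\<close> into level \<open>k\<close>, which is why
  the levels decrease in measure.\<close>

lemma antimono_measure_first_entrance:
  assumes C: "C \<in> sets M"
  shows "antimono (\<lambda>k. measure M (first_entrance C k))"
proof (rule decseq_SucI)
  fix k
  have "x \<in> T -` first_entrance C k \<inter> space M" if "x \<in> first_entrance C (Suc k)" for x
    using funpow_first_entrance[OF that, of 1] that unfolding first_entrance_def by auto
  then have "first_entrance C (Suc k) \<subseteq> T -` first_entrance C k \<inter> space M" by blast
  then have "measure M (first_entrance C (Suc k)) \<le> measure M (T -` first_entrance C k \<inter> space M)"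
    using C by (intro finite_measure_mono measurable_sets[OF T_measurable]) auto
  then show "measure M (first_entrance C (Suc k)) \<le> measure M (first_entrance C k)"
    using T_preserves C by simp
qed

text \<open>For \<open>j > 0\<close> the level \<open>j n\<close> is at most as large as each of the \<open>n\<close> levels below it. These blocks
  of \<open>n\<close> levels are disjoint, so the levels \<open>j n\<close> with \<open>j > 0\<close> have total measure at most \<open>1/n\<close>; the
  level \<open>0\<close> is \<open>C\<close>. From a point at level \<open>k\<close> it takes \<open>k mod n\<close> steps to reach a level divisible
  by \<open>n\<close>.\<close>

lemma skyscraper_marker:
  fixes n :: nat
  assumes C: "C \<in> sets M" and enter: "AE x in M. \<exists>k. (T ^^ k) x \<in> C" and n: "0 < n"
  obtains B where "B \<in> sets M" "measure M B \<le> measure M C + 1 / n"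
    "AE x in M. \<exists>i<n. (T ^^ i) x \<in> B"
proof
  let ?E = "first_entrance C"
  let ?e = "\<lambda>k. measure M (?E k)"
  let ?B = "\<Union>j. ?E (j * n)"
  show "?B \<in> sets M" using C by auto
  have disj: "disjoint_family (\<lambda>j. ?E (j * n))"
    using disjoint_first_entrance[of C] n by (auto simp: disjoint_family_on_def)
  have sums: "(\<lambda>j. ?e (j * n)) sums measure M ?B"
    using disj C by (intro finite_measure_UNION) auto
  have e0: "?e 0 = measure M C"
    using sets.sets_into_space[OF C] by (simp add: first_entrance_def Int_absorb2)
  have upper: "(\<Sum>j<m. ?e (Suc j * n)) \<le> 1 / n" for m
  proof -
    have "n * ?e (Suc j * n) \<le> sum ?e {j * n..<j * n + n}" for j
    proof -
      have "(\<Sum>k\<in>{j * n..<j * n + n}. ?e (Suc j * n)) \<le> sum ?e {j * n..<j * n + n}"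
        by (intro sum_mono antimonoD[OF antimono_measure_first_entrance[OF C]]) auto
      then show ?thesis by simp
    qed
    then have "(\<Sum>j<m. n * ?e (Suc j * n)) \<le> (\<Sum>j<m. sum ?e {j * n..<j * n + n})"
      by (intro sum_mono)
    also have "\<dots> = sum ?e {..<m * n}" by (rule sum.nat_group)
    also have "\<dots> = measure M (\<Union>k<m * n. ?E k)"
      using C disjoint_first_entrance[of C]
      by (intro finite_measure_finite_Union[symmetric]) (auto simp: disjoint_family_on_def)
    also have "\<dots> \<le> 1" by (rule prob_le_1)
    finally show ?thesis
      using n by (simp add: field_simps sum_distrib_left del: mult_Suc)
  qed
  have tail: "(\<lambda>j. ?e (Suc j * n)) sums (measure M ?B - measure M C)"
    using sums_Suc_iff[of "\<lambda>j. ?e (j * n)" "measure M ?B - measure M C"] sums e0 by simp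
  have "measure M ?B - measure M C \<le> 1 / n"
    using suminf_le_const[OF sums_summable[OF tail] upper] sums_unique[OF tail] by simp
  then show "measure M ?B \<le> measure M C + 1 / n" by simp
  show "AE x in M. \<exists>i<n. (T ^^ i) x \<in> ?B"
    using enter AE_space
  proof eventually_elim
    case (elim x)
    define k where "k = (LEAST k. (T ^^ k) x \<in> C)"
    have "x \<in> ?E k"
      using elim LeastI_ex[of "\<lambda>k. (T ^^ k) x \<in> C"] not_less_Least[of _ "\<lambda>k. (T ^^ k) x \<in> C"]
      unfolding first_entrance_def k_def by auto
    then have "(T ^^ (k mod n)) x \<in> ?E (k div n * n)"
      using funpow_first_entrance[of x C k "k mod n"] by (simp add: minus_mod_eq_div_mult)
    then show ?case using n by (intro exI[of _ "k mod n"]) auto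
  qed
qed

section \<open>A set with long absences\<close>

text \<open>The set is the complement of all \<open>pre k (B N)\<close> with \<open>k < N\<close>, where \<open>B N\<close> is a marker so small
  that these sets have total measure at most \<open>1/2\<close>. A visit to \<open>B N\<close> at time \<open>N\<close> or later then ends an
  absence of length \<open>N\<close>. The omitted steps are those leading up to the visit, hence preimages,
  because forward images under a non-invertible map need be neither measurable nor small.\<close>

lemma exists_set_with_long_absences:
  assumes markers: "\<And>\<delta>::real. 0 < \<delta> \<Longrightarrow>
    \<exists>B L. B \<in> sets M \<and> measure M B \<le> \<delta> \<and> (AE x in M. \<exists>i<L. (T ^^ i) x \<in> B)"
  obtains A where "A \<in> sets M" "0 < measure M A"
    "\<And>N. \<exists>L. AE x in M. \<exists>j<L. \<forall>i<N. (T ^^ (j + i)) x \<notin> A"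
proof -
  define \<delta> :: "nat \<Rightarrow> real" where "\<delta> N = (1/4) * (1/2) ^ N / real (N + 1)" for N
  have "0 < \<delta> N" for N by (simp add: \<delta>_def)
  then have "\<forall>N. \<exists>B L. B \<in> sets M \<and> measure M B \<le> \<delta> N \<and> (AE x in M. \<exists>i<L. (T ^^ i) x \<in> B)"
    using markers by blast
  from this[THEN choice] obtain B
    where "\<forall>N. \<exists>L. B N \<in> sets M \<and> measure M (B N) \<le> \<delta> N \<and> (AE x in M. \<exists>i<L. (T ^^ i) x \<in> B N)"
    by (rule exE)
  from this[THEN choice] obtain L
    where "\<forall>N. B N \<in> sets M \<and> measure M (B N) \<le> \<delta> N \<and> (AE x in M. \<exists>i<L N. (T ^^ i) x \<in> B N)"
    by (rule exE)
  then have B: "\<And>N. B N \<in> sets M" "\<And>N. measure M (B N) \<le> \<delta> N"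
      and visit: "\<And>N. AE x in M. \<exists>i<L N. (T ^^ i) x \<in> B N"
    by auto
  define R where "R N = (\<Union>k<N. pre k (B N))" for N
  have R_sets: "R N \<in> sets M" for N using B by (auto simp: R_def)
  have R_small: "measure M (R N) \<le> (1/4) * (1/2) ^ N" for N
  proof -
    have "measure M (R N) \<le> (\<Sum>k<N. measure M (pre k (B N)))"
      unfolding R_def using B by (intro finite_measure_subadditive_finite) auto
    also have "\<dots> = N * measure M (B N)" using B by (simp add: measure_pre)
    also have "\<dots> \<le> real (N + 1) * \<delta> N"
      using B(2)[of N] by (intro mult_mono) auto
    also have "\<dots> = (1/4) * (1/2) ^ N" 
      unfolding \<delta>_def times_divide_eq_right by (intro nonzero_mult_div_cancel_left) simp
    finally show ?thesis .
  qed
  have geo: "(\<lambda>N. (1/4) * (1/2::real) ^ N) sums (1/2)"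
    using sums_mult[OF geometric_sums[of "1/2::real"], of "1/4"] by simp
  have summ: "summable (\<lambda>N. measure M (R N))"
    using R_small by (intro summable_comparison_test'[OF sums_summable[OF geo], of 0]) auto
  have "measure M (\<Union>N. R N) \<le> (\<Sum>N. measure M (R N))"
    using R_sets summ by (intro finite_measure_subadditive_countably) auto
  also have "\<dots> \<le> 1/2"
    using suminf_le[OF R_small summ sums_summable[OF geo]] sums_unique[OF geo] by simp
  finally have R_half: "measure M (\<Union>N. R N) \<le> 1/2" .
  show ?thesis
  proof
    let ?A = "space M - (\<Union>N. R N)"
    show "?A \<in> sets M" using R_sets by auto
    show "0 < measure M ?A"
      using R_half R_sets prob_compl[of "\<Union>N. R N"] by auto
    fix N
    have "AE x in M. \<exists>i<L N. (T ^^ i) ((T ^^ N) x) \<in> B N"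
      using visit by (rule AE_funpow)
    then have "AE x in M. \<exists>j<L N + 1. \<forall>i<N. (T ^^ (j + i)) x \<notin> ?A"
      using AE_space
    proof eventually_elim
      case (elim x)
      then obtain i where i: "i < L N" "(T ^^ i) ((T ^^ N) x) \<in> B N" by auto
      have "(T ^^ (i + 1 + l)) x \<in> R N" if "l < N" for l
      proof -
        have "(T ^^ (N - 1 - l)) ((T ^^ (i + 1 + l)) x) = (T ^^ ((N - 1 - l) + (i + 1 + l))) x"
          by (simp only: funpow_add comp_apply)
        also have "(N - 1 - l) + (i + 1 + l) = i + N" using that by simp
        finally have "(T ^^ (i + 1 + l)) x \<in> pre (N - 1 - l) (B N)"
          using i elim funpow_in_space[of x "i + 1 + l"] by (simp add: funpow_add)
        moreover have "N - 1 - l < N" using that by simp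
        ultimately show ?thesis unfolding R_def by blast
      qed
      then show ?case using i(1) by (intro exI[of _ "i + 1"]) auto
    qed
    then show "\<exists>L. AE x in M. \<exists>j<L. \<forall>i<N. (T ^^ (j + i)) x \<notin> ?A" by blast
  qed
qed

section \<open>Consequences of independence of order two\<close>

lemma independent_pair:
  assumes ind: "family_independent syndetic_family M T 2"
    and "A \<in> sets M" "B \<in> sets M" "0 < measure M A" "0 < measure M B"
  obtains i j where "i < j"
    "\<And>U V. U \<in> {A, B} \<Longrightarrow> V \<in> {A, B} \<Longrightarrow> 0 < measure M (pre i U \<inter> pre j V)"
proof -
  define S where "S = (\<lambda>k::nat. if k = 1 then A else B)"
  have "Ind M T 2 S \<inter> syndetic_family \<noteq> {}"
    using ind assms unfolding family_independent_def S_def by auto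
  then obtain F where F: "independence_set M T 2 S F" "infinite F"
    by (auto simp: Ind_def syndetic_family_def syndetic_def)
  obtain i where i: "i \<in> F" using F(2) by (metis finite.emptyI ex_in_conv)
  obtain j where j: "j \<in> F" "i < j" using F(2) infinite_nat_iff_unbounded by blast
  have "0 < measure M (pre i U \<inter> pre j V)" if UV: "U \<in> {A, B}" "V \<in> {A, B}" for U V
  proof -
    define u v :: nat where "u = (if U = A then 1 else 2)" and "v = (if V = A then 1 else 2)"
    then have uv: "u \<in> {1..2}" "v \<in> {1..2}" "U = S u" "V = S v"
      using UV by (auto simp: S_def)
    define s where "s = (\<lambda>k. if k = i then u else v)"
    have "0 < measure M (\<Inter>k\<in>{i, j}. pre k (S (s k)))"
      using F(1)[unfolded independence_set_def, rule_format, of "{i, j}" s] i j uv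
      by (auto simp: s_def)
    then show ?thesis using j(2) uv by (simp add: s_def)
  qed
  with j(2) show ?thesis by (rule that)
qed

text \<open>Otherwise the points whose orbit avoids \<open>C\<close> would have positive measure, and no orbit is in that
  set at one time and in \<open>C\<close> at a later time.\<close>

lemma enters_almost_surely:
  assumes ind: "family_independent syndetic_family M T 2"
    and C: "C \<in> sets M" "0 < measure M C"
  shows "AE x in M. \<exists>k. (T ^^ k) x \<in> C"
proof (rule ccontr)
  assume no: "\<not> (AE x in M. \<exists>k. (T ^^ k) x \<in> C)"
  define D where "D = space M - (\<Union>k. pre k C)"
  have D: "D \<in> sets M" using C by (auto simp: D_def)
  have "measure M D \<noteq> 0"
  proof
    assume "measure M D = 0"
    then have "D \<in> null_sets M" using D by (auto simp: emeasure_eq_measure)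
    then have "AE x in M. \<exists>k. (T ^^ k) x \<in> C" by (rule AE_I') (auto simp: D_def)
    with no show False ..
  qed
  then have "0 < measure M D" by (simp add: zero_less_measure_iff)
  then obtain i j where ij: "i < j"
      "\<And>U V. U \<in> {D, C} \<Longrightarrow> V \<in> {D, C} \<Longrightarrow> 0 < measure M (pre i U \<inter> pre j V)"
    using independent_pair[OF ind D C(1) _ C(2)] by metis
  have "(T ^^ j) x = (T ^^ (j - i)) ((T ^^ i) x)" for x
    using ij(1) by (metis comp_apply funpow_add le_add_diff_inverse2 less_imp_le)
  then have "pre i D \<inter> pre j C = {}" by (auto simp: D_def)
  with ij(2)[of D C] show False by simp
qed

text \<open>The set \<open>pre i C\<close> is split by \<open>pre j C\<close> into two parts of positive measure; the smaller one
  halves the measure.\<close>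

lemma halve_measure:
  assumes ind: "family_independent syndetic_family M T 2"
    and C: "C \<in> sets M" "0 < measure M C" "measure M C < 1"
  obtains D where "D \<in> sets M" "0 < measure M D" "measure M D \<le> measure M C / 2"
proof -
  let ?C' = "space M - C"
  have C': "?C' \<in> sets M" "0 < measure M ?C'" using C by (auto simp: prob_compl)
  obtain i j where ij:
      "\<And>U V. U \<in> {C, ?C'} \<Longrightarrow> V \<in> {C, ?C'} \<Longrightarrow> 0 < measure M (pre i U \<inter> pre j V)"
    using independent_pair[OF ind C(1) C'(1) C(2) C'(2)] by metis
  have "(pre i C \<inter> pre j C) \<union> (pre i C \<inter> pre j ?C') = pre i C"
    using funpow_in_space by auto
  moreover have "measure M ((pre i C \<inter> pre j C) \<union> (pre i C \<inter> pre j ?C'))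
      = measure M (pre i C \<inter> pre j C) + measure M (pre i C \<inter> pre j ?C')"
    using C C' by (intro finite_measure_Union) auto
  ultimately have "measure M (pre i C \<inter> pre j C) + measure M (pre i C \<inter> pre j ?C') = measure M C"
    using C by (simp add: measure_pre)
  then consider "measure M (pre i C \<inter> pre j C) \<le> measure M C / 2"
    | "measure M (pre i C \<inter> pre j ?C') \<le> measure M C / 2" by linarith
  then show ?thesis
  proof cases
    case 1
    show ?thesis
      by (rule that[OF _ _ 1]) (use C(1) ij[of C C] in simp_all)
  next
    case 2
    show ?thesis
      by (rule that[OF _ _ 2]) (use C(1) C'(1) ij[of C ?C'] in simp_all)
  qed
qed

lemma small_positive_measure:
  assumes ind: "family_independent syndetic_family M T 2" and "nontrivial M" and "0 < (\<delta>::real)"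
  obtains C where "C \<in> sets M" "0 < measure M C" "measure M C \<le> \<delta>"
proof -
  have powers: "\<exists>C\<in>sets M. 0 < measure M C \<and> measure M C < 1 \<and> measure M C \<le> (1/2) ^ n" for n
  proof (induction n)
    case 0
    then show ?case using \<open>nontrivial M\<close> by (force simp: nontrivial_def)
  next
    case (Suc n)
    then obtain C where C: "C \<in> sets M" "0 < measure M C" "measure M C < 1"
        "measure M C \<le> (1/2) ^ n" by blast
    obtain D where "D \<in> sets M" "0 < measure M D" "measure M D \<le> measure M C / 2"
      using halve_measure[OF ind C(1-3)] .
    then show ?case using C by (intro bexI[of _ D]) auto
  qed
  obtain n where "(1/2) ^ n < \<delta>"
    using real_arch_pow_inv[OF \<open>0 < \<delta>\<close>, of "1/2"] by auto
  then show ?thesis using powers[of n] that by force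
qed

lemma small_markers:
  assumes ind: "family_independent syndetic_family M T 2" and "nontrivial M" and "0 < (\<delta>::real)"
  shows "\<exists>B L. B \<in> sets M \<and> measure M B \<le> \<delta> \<and> (AE x in M. \<exists>i<L. (T ^^ i) x \<in> B)"
proof -
  obtain C where C: "C \<in> sets M" "0 < measure M C" "measure M C \<le> \<delta> / 2"
    using small_positive_measure[OF assms(1,2), of "\<delta> / 2"] \<open>0 < \<delta>\<close> by auto
  obtain n :: nat where n: "0 < n" "1 / n < \<delta> / 2"
    using ex_inverse_of_nat_less[of "\<delta> / 2"] \<open>0 < \<delta>\<close> by (auto simp: divide_simps)
  obtain B where "B \<in> sets M" "measure M B \<le> measure M C + 1 / n"
      "AE x in M. \<exists>i<n. (T ^^ i) x \<in> B"
    using skyscraper_marker[OF C(1) enters_almost_surely[OF ind C(1,2)] n(1)] .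
  then show ?thesis using C(3) n(2) by (intro exI[of _ B] exI[of _ n]) auto
qed

end

section \<open>Syndetic sets meet the absences\<close>

lemma syndetic_meets_windows:
  assumes "syndetic F"
  obtains m N where "\<And>a. m \<le> a \<Longrightarrow> \<exists>k\<in>F. a \<le> k \<and> k < a + N"
proof -
  have inf: "infinite F" using assms by (simp add: syndetic_def)
  obtain K where K: "\<And>n. enumerate F (Suc n) - enumerate F n \<le> K"
    using assms by (auto simp: syndetic_def bdd_above_def)
  have "\<exists>k\<in>F. a \<le> k \<and> k < a + (K + 1)" if a: "enumerate F 0 \<le> a" for a
  proof -
    define n where "n = (LEAST n. a \<le> enumerate F n)"
    have n: "a \<le> enumerate F n"
      unfolding n_def by (rule LeastI[of _ a]) (rule le_enumerate[OF inf])
    have "enumerate F n < a + (K + 1)"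
    proof (cases n)
      case 0
      then show ?thesis using a by simp
    next
      case (Suc p)
      then have "enumerate F p < a"
        using not_less_Least[of p "\<lambda>n. a \<le> enumerate F n"] by (simp add: n_def)
      then show ?thesis using K[of p] unfolding Suc by linarith
    qed
    with n show ?thesis using enumerate_in_set[OF inf] by blast
  qed
  then show ?thesis by (rule that)
qed

text \<open>Independence of the pair \<open>(A, A)\<close> along \<open>F\<close> means that presence in \<open>A\<close> at all times of any finite
  part of \<open>F\<close> has positive probability. A part long enough to meet an absence that starts within \<open>L\<close>
  steps of time \<open>m\<close> contradicts this; \<open>m\<close> is the time from which \<open>F\<close> meets every window of
  length \<open>N\<close>.\<close>

lemma (in measure_preserving_map) no_syndetic_independence:
  assumes A: "A \<in> sets M"
    and absent: "\<And>N. \<exists>L. AE x in M. \<exists>j<L. \<forall>i<N. (T ^^ (j + i)) x \<notin> A"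
    and "syndetic F"
  shows "\<not> independence_set M T 2 (\<lambda>_. A) F"
proof
  assume F: "independence_set M T 2 (\<lambda>_. A) F"
  obtain m N where window: "\<And>a. m \<le> a \<Longrightarrow> \<exists>k\<in>F. a \<le> k \<and> k < a + N"
    using syndetic_meets_windows[OF \<open>syndetic F\<close>] by blast
  obtain L where L: "AE x in M. \<exists>j<L. \<forall>i<N. (T ^^ (j + i)) x \<notin> A"
    using absent by blast
  define J where "J = F \<inter> {..<m + L + N}"
  have "J \<noteq> {}" using window[of m] by (force simp: J_def)
  then have pos: "0 < measure M (\<Inter>j\<in>J. pre j A)"
    using F[unfolded independence_set_def, rule_format, of J "\<lambda>_. 1"] by (auto simp: J_def)
  have "AE x in M. \<exists>j<L. \<forall>i<N. (T ^^ (j + i)) ((T ^^ m) x) \<notin> A"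
    using L by (rule AE_funpow)
  then have "AE x in M. x \<notin> (\<Inter>j\<in>J. pre j A)"
  proof eventually_elim
    case (elim x)
    then obtain j where j: "j < L" "\<And>i. i < N \<Longrightarrow> (T ^^ (j + i)) ((T ^^ m) x) \<notin> A" by blast
    obtain k where k: "k \<in> F" "m + j \<le> k" "k < m + j + N"
      using window[of "m + j"] by auto
    have "(T ^^ k) x \<notin> A"
    proof -
      have "k = (j + (k - m - j)) + m" using k by simp
      then have "(T ^^ k) x = (T ^^ (j + (k - m - j))) ((T ^^ m) x)"
        by (metis comp_apply funpow_add)
      then show ?thesis using j(2)[of "k - m - j"] k by auto
    qed
    moreover have "k \<in> J" using k j(1) by (simp add: J_def)
    ultimately show ?case by auto
  qed
  moreover have "(\<Inter>j\<in>J. pre j A) \<in> sets M"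
    using A \<open>J \<noteq> {}\<close> by (intro sets.finite_INT) (auto simp: J_def)
  ultimately have "measure M (\<Inter>j\<in>J. pre j A) = 0"
    by (subst prob_eq_0)
  with pos show False by simp
qed

theorem theorem6p9:
  shows "\<not> (\<exists>(M :: 'a measure) T.
           mds M T \<and> nontrivial M \<and> family_independent syndetic_family M T 2)"
proof
  assume "\<exists>(M :: 'a measure) T.
           mds M T \<and> nontrivial M \<and> family_independent syndetic_family M T 2"
  then obtain M :: "'a measure" and T where mds: "mds M T" and nontriv: "nontrivial M"
      and ind: "family_independent syndetic_family M T 2" by blast
  interpret prob_space M using mds by (simp add: mds_def lebesgue_space_def)
  interpret measure_preserving_map M T
    using mds by unfold_locales (auto simp: mds_def)
  obtain A where A: "A \<in> sets M" "0 < measure M A"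
      and absent: "\<And>N. \<exists>L. AE x in M. \<exists>j<L. \<forall>i<N. (T ^^ (j + i)) x \<notin> A"
    using exists_set_with_long_absences[OF small_markers[OF ind nontriv]] by blast
  have "Ind M T 2 (\<lambda>_. A) \<inter> syndetic_family \<noteq> {}"
    using ind A by (simp add: family_independent_def)
  then show False
    using no_syndetic_independence[OF A(1) absent] by (auto simp: Ind_def syndetic_family_def)
qed

end
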